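(* For every $0<\varepsilon<1$ there exist a measurable set $E\subset\mathbb T$ and an increasing sequence of positive integers $(n_j)_{j\ge1}$ with $n_{j+1}/n_j\ge2$ for all $j$ such that $|E|<\varepsilon$ and, for almost every $x\in\mathbb T$, $$\limsup_{N\to\infty}\frac1N\sum_{j\le N}\mathbf 1_E(n_jx)=1.$$ Consequently, for the bounded mean-zero function $g=\mathbf 1_E-|E|$, it is not the case that the averages $\frac1N\sum_{j\le N}g(n_jx)$ converge for almost every $x\in\mathbb T$.
   Context: $\mathbb T=\mathbb R/\mathbb Z$ with normalized Lebesgue measure $|\cdot|$; $\mathbf 1_E$ is the indicator function of $E$. *)

theory Defs
  imports "HOL-Analysis.Analysis"
begin

quotient_type circle = real / "\<lambda>x y. x - y \<in> \<int>"
  morphisms rep_circle circle_proj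
proof (rule equivpI)
  show "reflp (\<lambda>x y::real. x - y \<in> \<int>)"
    by (simp add: reflp_def)
  show "symp (\<lambda>x y::real. x - y \<in> \<int>)"
  proof (rule sympI)
    fix x y :: real
    assume "x - y \<in> \<int>"
    then have "- (x - y) \<in> \<int>"
      by (rule Ints_minus)
    then show "y - x \<in> \<int>"
      by simp
  qed
  show "transp (\<lambda>x y::real. x - y \<in> \<int>)"
  proof (rule transpI)
    fix x y z :: real
    assume "x - y \<in> \<int>" "y - z \<in> \<int>"
    then have "(x - y) + (y - z) \<in> \<int>"
      by (rule Ints_add)
    then show "x - z \<in> \<int>"
      by simp
  qed
qed

lemma circle_proj_eq_iff: "circle_proj x = circle_proj y \<longleftrightarrow> x - y \<in> \<int>"
  using circle.abs_eq_iff .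

lift_definition circle_mult :: "nat \<Rightarrow> circle \<Rightarrow> circle" is "\<lambda>n x. real n * x"
proof -
  fix n and x y :: real
  assume "x - y \<in> \<int>"
  then have "real n * (x - y) \<in> \<int>"
    by (intro Ints_mult) auto
  then show "real n * x - real n * y \<in> \<int>"
    by (simp add: algebra_simps)
qed

definition circle_sigma :: "circle measure" where
  "circle_sigma = sigma UNIV {E. circle_proj -` E \<in> sets lebesgue}"

text \<open>Normalized Lebesgue measure on \<open>\<real>/\<int>\<close>: \<open>{0..<1}\<close> is a fundamental domain for the
  projection, and the measurable sets are those with Lebesgue measurable preimage in \<open>\<real>\<close>
  (not only the Borel ones).\<close>

definition circle_measure :: "circle measure" where
  "circle_measure = distr (lebesgue_on {0..<1}) circle_sigma circle_proj"

lemma space_circle_measure [simp]: "space circle_measure = UNIV"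
  by (simp add: circle_measure_def circle_sigma_def space_measure_of)

lemma sets_circle_sigma: "sets circle_sigma = {E. circle_proj -` E \<in> sets lebesgue}"
proof -
  have "sigma_algebra (UNIV :: circle set) {E. circle_proj -` E \<in> sets lebesgue}"
  proof (subst sigma_algebra_iff2, intro conjI ballI allI impI)
    fix E assume "E \<in> {E. circle_proj -` E \<in> sets lebesgue}"
    then have "space lebesgue - circle_proj -` E \<in> sets lebesgue"
      by (intro sets.compl_sets) simp
    then show "UNIV - E \<in> {E. circle_proj -` E \<in> sets lebesgue}"
      by (simp add: vimage_Diff)
  next
    fix A :: "nat \<Rightarrow> circle set"
    assume "range A \<subseteq> {E. circle_proj -` E \<in> sets lebesgue}"
    then have "(\<Union>i. circle_proj -` A i) \<in> sets lebesgue"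
      by (intro sets.countable_UN) auto
    then show "(\<Union>i. A i) \<in> {E. circle_proj -` E \<in> sets lebesgue}"
      by (simp add: vimage_UN)
  qed auto
  then show ?thesis
    by (simp add: circle_sigma_def sigma_algebra.sigma_sets_eq)
qed

lemma sets_circle_measure: "E \<in> sets circle_measure \<longleftrightarrow> circle_proj -` E \<in> sets lebesgue"
  by (simp add: circle_measure_def sets_circle_sigma)

lemma measurable_circle_proj: "circle_proj \<in> measurable (lebesgue_on {0..<1}) circle_sigma"
proof (rule measurableI)
  fix E assume "E \<in> sets circle_sigma"
  then have "circle_proj -` E \<in> sets lebesgue"
    by (simp add: sets_circle_sigma)
  then show "circle_proj -` E \<inter> space (lebesgue_on {0..<1}) \<in> sets (lebesgue_on {0..<1})"
    by (simp add: sets_restrict_space space_restrict_space Int_commute)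
qed (simp add: circle_sigma_def space_measure_of)

lemma emeasure_circle_measure:
  assumes "E \<in> sets circle_measure"
  shows "emeasure circle_measure E = emeasure lebesgue (circle_proj -` E \<inter> {0..<1})"
proof -
  have "E \<in> sets circle_sigma"
    using assms by (simp add: circle_measure_def)
  then show ?thesis
    by (simp add: circle_measure_def emeasure_distr[OF measurable_circle_proj]
        emeasure_restrict_space space_restrict_space)
qed

lemma emeasure_circle_measure_UNIV: "emeasure circle_measure UNIV = 1"
proof -
  have "UNIV \<in> sets circle_measure"
    by (simp add: sets_circle_measure)
  then show ?thesis
    by (simp add: emeasure_circle_measure)
qed

end

theory Submission
  imports Defs
begin

text \<open>For the map \<open>x \<mapsto> q x\<close>, let \<open>\<tau> x\<close> be the position of the first zero digit of \<open>x\<close> in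
  base \<open>q\<close>; then \<open>\<tau> (q ^ a x) = \<tau> x - a\<close> as long as \<open>a \<le> \<tau> x\<close>. The set where \<open>B\<close> divides \<open>\<tau>\<close>
  has measure about \<open>1 / B\<close>, and \<open>q ^ a x\<close> lies in it as soon as \<open>a \<le> \<tau> x\<close> and
  \<open>a\<close> is congruent to \<open>\<tau> x\<close> modulo \<open>B\<close>. Arrange the exponents in \<open>B\<close> consecutive blocks, each much
  longer than everything before it, the exponents of each block having one residue modulo \<open>B\<close>, and
  choose \<open>q\<close> so large that \<open>\<tau>\<close> is rarely smaller than the last exponent. For most \<open>x\<close> the
  average is then close to 1 at the end of the block whose residue is that of \<open>\<tau> x\<close>. Repeating
  this with \<open>B = 2 ^ k\<close> for all large \<open>k\<close> and taking the union of the sets gives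
  limsup 1 almost everywhere by the Borel-Cantelli lemma. Almost everywhere convergence would then
  contradict dominated convergence, because every average has mean \<open>|E|\<close>.\<close>

section \<open>The circle as a probability space and invariance under
  \<open>circle_mult\<close>\<close>

interpretation circle: finite_measure circle_measure
  by (rule finite_measureI) (simp add: emeasure_circle_measure_UNIV)

lemma measure_circle_UNIV [simp]: "measure circle_measure UNIV = 1"
  by (simp add: measure_def emeasure_circle_measure_UNIV)

lemma measure_circle_le_1: "measure circle_measure D \<le> 1"
  using circle.bounded_measure[of D] by simp

lemma measure_circle_measure:
  assumes "E \<in> sets circle_measure"
  shows "measure circle_measure E = measure lebesgue (circle_proj -` E \<inter> {0..<1})"
  using emeasure_circle_measure[OF assms] by (simp add: measure_def)

lemma circle_mult_proj: "circle_mult n (circle_proj x) = circle_proj (real n * x)"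
  by (rule circle_mult.abs_eq)

lemma circle_mult_mult: "circle_mult m (circle_mult n x) = circle_mult (m * n) x"
  by transfer (simp add: mult.assoc)

lemma circle_mult_1 [simp]: "circle_mult (Suc 0) x = x"
  by transfer simp

lemma measurable_circle_mult [measurable]: "circle_mult n \<in> circle_measure \<rightarrow>\<^sub>M circle_measure"
proof (rule measurableI)
  fix D assume "D \<in> sets circle_measure"
  then have "circle_proj -` D \<in> sets lebesgue"
    by (simp add: sets_circle_measure)
  then have "(*\<^sub>R) (real n) -` (circle_proj -` D) \<inter> space lebesgue \<in> sets lebesgue"
    by (rule measurable_sets[OF lebesgue_measurable_scaling])
  also have "(*\<^sub>R) (real n) -` (circle_proj -` D) \<inter> space lebesgue
      = circle_proj -` (circle_mult n -` D)"
    by (auto simp: circle_mult_proj)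
  finally show "circle_mult n -` D \<inter> space circle_measure \<in> sets circle_measure"
    by (simp add: sets_circle_measure)
qed simp

text \<open>On the \<open>d\<close>-th interval of length 1/n, y \<mapsto> n y - d maps affinely
  onto the fundamental domain, so \<open>P d\<close> is a copy of the lift of \<open>D\<close>,
  shrunk by the factor n and translated.\<close>

lemma measure_branch:
  assumes "D \<in> sets circle_measure" "0 < n"
  defines "P \<equiv> \<lambda>d::nat. {y. circle_proj (real n * y) \<in> D \<and> real d / n \<le> y \<and> y < real (Suc d) / n}"
  shows "P d \<in> sets lebesgue" "measure lebesgue (P d) = measure circle_measure D / n"
proof -
  let ?F = "circle_proj -` D \<inter> {0..<1}"
  have "P d = circle_proj -` (circle_mult n -` D \<inter> space circle_measure) \<inter> {real d / n..<real (Suc d) / n}"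
    by (auto simp: P_def circle_mult_proj)
  moreover have "circle_proj -` (circle_mult n -` D \<inter> space circle_measure) \<in> sets lebesgue"
    using measurable_sets[OF measurable_circle_mult assms(1)] sets_circle_measure by blast
  ultimately show "P d \<in> sets lebesgue"
    by auto
  have "P d = (\<lambda>z. (1 / real n) *\<^sub>R z + real d / n) ` ?F"
  proof (intro equalityI subsetI)
    fix y assume y: "y \<in> P d"
    have "circle_proj (real n * y - real d) = circle_proj (real n * y)"
      by (simp add: circle_proj_eq_iff)
    with y have "real n * y - real d \<in> ?F"
      using assms(2) by (auto simp: P_def field_simps)
    moreover have "y = (1 / real n) *\<^sub>R (real n * y - real d) + real d / n"
      using assms(2) by (simp add: field_simps)
    ultimately show "y \<in> (\<lambda>z. (1 / real n) *\<^sub>R z + real d / n) ` ?F"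
      by blast
  next
    fix y assume "y \<in> (\<lambda>z. (1 / real n) *\<^sub>R z + real d / n) ` ?F"
    then obtain z where z: "z \<in> ?F" "y = (1 / real n) *\<^sub>R z + real d / n"
      by blast
    have "real n * y = z + real d"
      using z(2) assms(2) by (simp add: field_simps)
        moreover have "circle_proj (z + real d) = circle_proj z"
      by (simp add: circle_proj_eq_iff)
    ultimately show "y \<in> P d"
      using z assms(2) by (auto simp: P_def field_simps)
  qed
  then show "measure lebesgue (P d) = measure circle_measure D / n"
    using measure_lebesgue_affine[of "1 / real n" "real d / n" ?F]
    by (simp add: measure_circle_measure[OF assms(1)])
qed

text \<open>The preimage splits into \<open>n\<close> disjoint branches, each carrying the fraction
  1/n of the measure of \<open>D\<close>.\<close>

lemma measure_circle_mult_vimage: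
  assumes "D \<in> sets circle_measure" "0 < n"
  shows "measure circle_measure (circle_mult n -` D) = measure circle_measure D"
proof -
  define P where "P = (\<lambda>d::nat. {y. circle_proj (real n * y) \<in> D \<and> real d / n \<le> y \<and> y < real (Suc d) / n})"
  have P: "P d \<in> sets lebesgue" "measure lebesgue (P d) = measure circle_measure D / n" for d
    unfolding P_def using measure_branch[OF assms] by auto
  have "circle_mult n -` D \<in> sets circle_measure"
    using measurable_sets[OF measurable_circle_mult assms(1)] by simp
  then have "measure circle_measure (circle_mult n -` D)
      = measure lebesgue (circle_proj -` (circle_mult n -` D) \<inter> {0..<1})"
    by (rule measure_circle_measure)
  also have "circle_proj -` (circle_mult n -` D) \<inter> {0..<1} = (\<Union>d<n. P d)"
  proof (intro equalityI subsetI)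
    fix y assume y: "y \<in> circle_proj -` (circle_mult n -` D) \<inter> {0..<1}"
    \<comment> \<open>The integer part of n y is the index of the branch containing y.\<close>
    define d where "d = nat \<lfloor>real n * y\<rfloor>"
    have "0 \<le> real n * y" "real n * y < real n"
      using y assms(2) by auto
    then have d: "real d \<le> real n * y" "real n * y < real d + 1"
      unfolding d_def by linarith+
    then have "d < n"
      using \<open>real n * y < real n\<close> by linarith
    moreover have "y \<in> P d"
      using y d assms(2) by (auto simp: P_def circle_mult_proj field_simps)
    ultimately show "y \<in> (\<Union>d<n. P d)" by blast
  next
    fix y assume "y \<in> (\<Union>d<n. P d)"
    then obtain d where d: "d < n" "y \<in> P d" by blast
    have "real (Suc d) / n \<le> 1"
      using d(1) by simp
    moreover have "0 \<le> real d / n" by simp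
    ultimately have "0 \<le> y" "y < 1"
      using d(2) unfolding P_def mem_Collect_eq by (linarith, linarith)
    then show "y \<in> circle_proj -` (circle_mult n -` D) \<inter> {0..<1}"
      using d(2) by (simp add: P_def circle_mult_proj)
  qed
  also have "measure lebesgue (\<Union>d<n. P d) = (\<Sum>d<n. measure lebesgue (P d))"
  proof (rule measure_finite_Union)
    have "P d \<inter> P e = {}" if "d < e" for d e
    proof -
      have "real (Suc d) / n \<le> real e / n"
        using that by (intro divide_right_mono) auto
      then show ?thesis
        by (auto simp: P_def simp del: of_nat_Suc)
    qed
    then show "disjoint_family_on P {..<n}"
      unfolding disjoint_family_on_def by (metis inf_commute linorder_neqE_nat)
    fix d
    have "emeasure lebesgue (P d) \<le> emeasure lebesgue {real d / n..real (Suc d) / n}"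
      by (rule emeasure_mono) (auto simp: P_def)
    also have "\<dots> < \<infinity>"
      by (simp add: divide_right_mono)
    finally show "emeasure lebesgue (P d) \<noteq> \<infinity>" by simp
  qed (use P in auto)
  finally show ?thesis
    using P(2) assms(2) by simp
qed

section \<open>Digits in base \<open>q\<close>: zero first digit, hitting times and residue classes
  of hitting times\<close>

definition cell :: "nat \<Rightarrow> circle set" where
  "cell q = circle_proj ` {0..<1 / real q}"

lemma circle_proj_in_cell_iff: "0 < q \<Longrightarrow> circle_proj y \<in> cell q \<longleftrightarrow> frac y < 1 / q"
proof
  assume "0 < q" "circle_proj y \<in> cell q"
  then obtain z where z: "circle_proj y = circle_proj z" "0 \<le> z" "z < 1 / q"
    by (auto simp: cell_def)
  then have "y - z \<in> \<int>"
    by (simp add: circle_proj_eq_iff)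
  moreover have "z < 1"
    using z(3) \<open>0 < q\<close> less_le_trans[of z "1 / real q" 1] by simp
  ultimately have "frac y = z"
    using z(2) by (simp add: frac_unique_iff)
  then show "frac y < 1 / q"
    using z by simp
next
  assume "frac y < 1 / q"
  moreover have "circle_proj y = circle_proj (frac y)"
    by (simp add: circle_proj_eq_iff frac_def)
  ultimately show "circle_proj y \<in> cell q"
    unfolding cell_def by auto
qed

lemma cell_in_sets [measurable]: "0 < q \<Longrightarrow> cell q \<in> sets circle_measure"
proof -
  assume q: "0 < q"
  have "circle_proj -` cell q = {y. frac y < 1 / q}"
    using circle_proj_in_cell_iff[OF q] by auto
  also have "\<dots> \<in> sets borel"
    unfolding frac_def by measurable
  finally show ?thesis
    by (simp add: sets_circle_measure)
qed

text \<open>Independence of the first digit from all later ones: \<open>cell q\<close> is branch 0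
  of multiplication by \<open>q\<close>.\<close>

lemma measure_cell_vimage:
  assumes "D \<in> sets circle_measure" "0 < q"
  shows "measure circle_measure (cell q \<inter> circle_mult q -` D) = measure circle_measure D / q"
proof -
  let ?P = "{y. circle_proj (real q * y) \<in> D \<and> real 0 / q \<le> y \<and> y < real (Suc 0) / q}"
  have "cell q \<inter> (circle_mult q -` D \<inter> space circle_measure) \<in> sets circle_measure"
    by (intro sets.Int measurable_sets[OF measurable_circle_mult] cell_in_sets assms)
  then have "measure circle_measure (cell q \<inter> circle_mult q -` D)
      = measure lebesgue (circle_proj -` (cell q \<inter> circle_mult q -` D) \<inter> {0..<1})"
    by (simp add: measure_circle_measure)
  also have "circle_proj -` (cell q \<inter> circle_mult q -` D) \<inter> {0..<1} = ?P"
  proof -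
    have "1 / real q \<le> 1"
      using assms(2) by simp
    then have eq: "frac y < 1 / q \<and> 0 \<le> y \<and> y < 1 \<longleftrightarrow> 0 \<le> y \<and> y < 1 / q" for y
      by (cases "0 \<le> y \<and> y < 1") (auto simp: frac_eq)
    show ?thesis
    proof (intro set_eqI)
      fix y
      show "y \<in> circle_proj -` (cell q \<inter> circle_mult q -` D) \<inter> {0..<1} \<longleftrightarrow> y \<in> ?P"
        using eq[of y] by (simp add: circle_proj_in_cell_iff[OF assms(2)] circle_mult_proj) blast
    qed
  qed
  finally show ?thesis
    using measure_branch(2)[OF assms, of 0] by simp
qed

lemma measure_cell: "0 < q \<Longrightarrow> measure circle_measure (cell q) = 1 / q"
  using measure_cell_vimage[of UNIV q] by (simp add: sets_circle_measure)

text \<open>The level set \<tau> = t of the hitting time, digits being counted from 0. Level sets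
  avoid choosing a value of \<tau> at points without any zero digit.\<close>

definition first_hit :: "nat \<Rightarrow> nat \<Rightarrow> circle set" where
  "first_hit q t = {x. circle_mult (q ^ t) x \<in> cell q \<and> (\<forall>s<t. circle_mult (q ^ s) x \<notin> cell q)}"

lemma first_hit_in_sets [measurable]:
  assumes "0 < q"
  shows "first_hit q t \<in> sets circle_measure"
proof -
  have [measurable]: "cell q \<in> sets circle_measure"
    using assms by (rule cell_in_sets)
  have "{x \<in> space circle_measure. circle_mult (q ^ t) x \<in> cell q \<and> (\<forall>s<t. circle_mult (q ^ s) x \<notin> cell q)}
      \<in> sets circle_measure"
    by measurable
  then show ?thesis
    by (simp add: first_hit_def)
qed

lemma first_hit_disjoint: "x \<in> first_hit q s \<Longrightarrow> x \<in> first_hit q t \<Longrightarrow> s = t"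
  unfolding first_hit_def by (cases s t rule: linorder_cases) auto

lemma disjoint_family_first_hit: "disjoint_family (first_hit q)"
  unfolding disjoint_family_on_def using first_hit_disjoint by blast

lemma first_hit_shift:
  assumes "x \<in> first_hit q t" "a \<le> t"
  shows "circle_mult (q ^ a) x \<in> first_hit q (t - a)"
  using assms by (auto simp: first_hit_def circle_mult_mult simp flip: power_add)

text \<open>Dropping the first t - s digits sends level t into level s, and the preimage of level s
  has the same measure as level s.\<close>

lemma measure_first_hit_antimono:
  assumes "0 < q" "s \<le> t"
  shows "measure circle_measure (first_hit q t) \<le> measure circle_measure (first_hit q s)"
proof -
  have "measure circle_measure (first_hit q t)
      \<le> measure circle_measure (circle_mult (q ^ (t - s)) -` first_hit q s \<inter> space circle_measure)"
  proof (rule circle.finite_measure_mono)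
    show "first_hit q t \<subseteq> circle_mult (q ^ (t - s)) -` first_hit q s \<inter> space circle_measure"
      using first_hit_shift[of _ q t "t - s"] assms(2) by auto
  qed (use assms in \<open>intro measurable_sets[OF measurable_circle_mult] first_hit_in_sets\<close>)
  also have "\<dots> = measure circle_measure (first_hit q s)"
    using assms measure_circle_mult_vimage[of "first_hit q s" "q ^ (t - s)"] by simp
  finally show ?thesis .
qed

lemma measure_first_hit_le: "0 < q \<Longrightarrow> measure circle_measure (first_hit q t) \<le> 1 / q"
  using measure_first_hit_antimono[of q 0 t] measure_cell by (simp add: first_hit_def)

text \<open>Digits are independent, so the first k of them all avoid zero with probability (1 -
  1/q)^k, which tends to 0.\<close>

lemma AE_first_hit:
  assumes "0 < q"
  shows "AE x in circle_measure. \<exists>t. x \<in> first_hit q t"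
proof -
  define C where "C = (\<lambda>k. {x. \<forall>s<k. circle_mult (q ^ s) x \<notin> cell q})"
  have C_sets: "C k \<in> sets circle_measure" for k
  proof -
    have [measurable]: "cell q \<in> sets circle_measure"
      using assms by (rule cell_in_sets)
    have "{x \<in> space circle_measure. \<forall>s<k. circle_mult (q ^ s) x \<notin> cell q} \<in> sets circle_measure"
      by measurable
    then show ?thesis by (simp add: C_def)
  qed
  have measure_C: "measure circle_measure (C k) = (1 - 1 / q) ^ k" for k
  proof (induction k)
    case 0
    then show ?case by (simp add: C_def)
  next
    case (Suc k)
    let ?T = "circle_mult q -` C k"
    have T: "?T \<in> sets circle_measure"
      using measurable_sets[OF measurable_circle_mult C_sets] by simp
    \<comment> \<open>The first k + 1 digits avoid zero iff the first one does and the point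
      multiplied by \<open>q\<close> avoids zero in its first k digits.\<close>
    have "C (Suc k) = ?T - cell q \<inter> ?T"
      by (auto simp: C_def circle_mult_mult less_Suc_eq_0_disj mult.commute)
    then have "measure circle_measure (C (Suc k))
        = measure circle_measure ?T - measure circle_measure (cell q \<inter> ?T)"
      using circle.finite_measure_Diff[of ?T "cell q \<inter> ?T"] T cell_in_sets[OF assms] by auto
    also have "\<dots> = (1 - 1 / q) * measure circle_measure (C k)"
      by (simp add: measure_circle_mult_vimage measure_cell_vimage C_sets assms field_simps)
    finally show ?case
      by (simp add: Suc)
  qed
  have "(\<lambda>k. (1 - 1 / real q) ^ k) \<longlonglongrightarrow> 0"
    using assms by (intro LIMSEQ_power_zero) auto
  moreover have "measure circle_measure (\<Inter>k. C k) \<le> (1 - 1 / q) ^ k" for k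
    unfolding measure_C[symmetric] by (rule circle.finite_measure_mono) (use C_sets in auto)
  ultimately have "measure circle_measure (\<Inter>k. C k) \<le> 0"
    by (intro LIMSEQ_le_const[where X = "\<lambda>k. (1 - 1 / real q) ^ k"]) auto
  then have "measure circle_measure (\<Inter>k. C k) = 0"
    by (intro antisym) auto
  then have "(\<Inter>k. C k) \<in> null_sets circle_measure"
    using C_sets by (intro null_setsI) (auto simp: circle.emeasure_eq_measure)
  moreover have "\<exists>t. x \<in> first_hit q t" if x: "x \<notin> (\<Inter>k. C k)" for x
  proof -
    have "\<exists>s. circle_mult (q ^ s) x \<in> cell q"
      using x by (auto simp: C_def)
    then obtain t where "circle_mult (q ^ t) x \<in> cell q" "\<forall>s<t. circle_mult (q ^ s) x \<notin> cell q"
      using exists_least_iff[of "\<lambda>s. circle_mult (q ^ s) x \<in> cell q"] by auto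
    then show ?thesis
      unfolding first_hit_def by blast
  qed
  ultimately show ?thesis
    by (intro AE_I'[of "\<Inter>k. C k"]) auto
qed

text \<open>Level zero is included, so that multiplying by \<open>q ^ a\<close> still lands in the
  set when \<open>a\<close> equals the hitting time.\<close>

definition hit_mod :: "nat \<Rightarrow> nat \<Rightarrow> circle set" where
  "hit_mod q B = (\<Union>i. first_hit q (i * B))"

lemma hit_mod_in_sets: "0 < q \<Longrightarrow> hit_mod q B \<in> sets circle_measure"
  unfolding hit_mod_def by (intro sets.countable_UN') auto

text \<open>The measures of the level sets of the hitting time decrease, so the levels divisible by
  \<open>B\<close> carry at most the fraction \<open>1 / B\<close> of the mass, apart from level zero.\<close>

lemma measure_hit_mod_le:
  assumes "0 < q" "0 < B"
  shows "measure circle_measure (hit_mod q B) \<le> 1 / q + 1 / B"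
proof -
  define f where "f = (\<lambda>t. measure circle_measure (first_hit q t))"
  have f_antimono: "f t \<le> f s" if "s \<le> t" for s t
    unfolding f_def using assms(1) that by (rule measure_first_hit_antimono)
  have "f sums measure circle_measure (\<Union>t. first_hit q t)"
    unfolding f_def
    by (rule circle.finite_measure_UNION) (use disjoint_family_first_hit assms in auto)
  then have f_suminf: "summable f" "suminf f \<le> 1"
    using measure_circle_le_1 by (auto simp: sums_iff)
  have f_sum: "sum f {..<n} \<le> 1" for n
    using sum_le_suminf[OF f_suminf(1), of "{..<n}"] f_suminf(2) by (simp add: f_def)
  have le: "(\<Sum>i<n. f (i * B)) \<le> 1 / q + 1 / B" for n
  proof (cases n)
    case (Suc m)
    \<comment> \<open>Level \<open>Suc i * B\<close> is charged to the \<open>B\<close> levels just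
      before it, each at least as heavy; these groups are disjoint and have total mass at most
      1.\<close>
    have "B * (\<Sum>i<m. f (Suc i * B)) = (\<Sum>i<m. \<Sum>t\<in>{i * B..<i * B + B}. f (Suc i * B))"
      by (simp add: sum_distrib_left)
    also have "\<dots> \<le> (\<Sum>i<m. sum f {i * B..<i * B + B})"
      by (intro sum_mono f_antimono) auto
    also have "\<dots> = sum f {..<m * B}"
      by (rule sum.nat_group)
    finally have "B * (\<Sum>i<m. f (Suc i * B)) \<le> 1"
      using f_sum[of "m * B"] by linarith
    then have "(\<Sum>i<m. f (Suc i * B)) \<le> 1 / B"
      using assms(2) by (simp add: field_simps)
    moreover have "f 0 \<le> 1 / q"
      unfolding f_def using assms(1) by (rule measure_first_hit_le)
    ultimately show ?thesis
      unfolding Suc sum.lessThan_Suc_shift by (simp add: add_mono)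
  qed simp
  have "(\<lambda>i. f (i * B)) sums measure circle_measure (hit_mod q B)"
    unfolding f_def hit_mod_def
  proof (rule circle.finite_measure_UNION)
    show "disjoint_family (\<lambda>i. first_hit q (i * B))"
      unfolding disjoint_family_on_def
    proof (intro ballI impI)
      fix i j :: nat assume "i \<noteq> j"
      then have "i * B \<noteq> j * B" using assms(2) by simp
      then show "first_hit q (i * B) \<inter> first_hit q (j * B) = {}"
        using first_hit_disjoint by blast
    qed
  qed (use assms in auto)
  then show ?thesis
    unfolding sums_def using le by (intro LIMSEQ_le_const2) auto
qed

lemma circle_mult_in_hit_mod:
  assumes "x \<in> first_hit q t" "a \<le> t" "a mod B = t mod B"
  shows "circle_mult (q ^ a) x \<in> hit_mod q B"
proof -
  obtain i where "t - a = i * B"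
    using assms(2,3) by (metis dvd_def mod_eq_dvd_iff_nat mult.commute)
  then show ?thesis
    using first_hit_shift[OF assms(1,2)] by (auto simp: hit_mod_def)
qed

section \<open>From limsup 1 to failure of almost everywhere convergence\<close>

lemma limsup_ereal_eq_1:
  fixes X :: "nat \<Rightarrow> real"
  assumes le: "\<And>N. X N \<le> 1" and ge: "\<And>e M. 0 < e \<Longrightarrow> \<exists>N\<ge>M. 1 - e \<le> X N"
  shows "limsup (\<lambda>N. ereal (X N)) = 1"
proof (rule antisym)
  show "limsup (\<lambda>N. ereal (X N)) \<le> 1"
    using le by (intro Limsup_bounded always_eventually) (simp add: one_ereal_def)
  show "1 \<le> limsup (\<lambda>N. ereal (X N))"
  proof (rule ccontr)
    assume "\<not> 1 \<le> limsup (\<lambda>N. ereal (X N))"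
    then have "limsup (\<lambda>N. ereal (X N)) < ereal 1"
      by (simp add: one_ereal_def)
    then obtain c where c: "limsup (\<lambda>N. ereal (X N)) < ereal c" "c < 1"
      using ereal_dense2 by (metis less_ereal.simps(1))
    then have "eventually (\<lambda>N. ereal (X N) < ereal c) sequentially"
      by (intro Limsup_lessD)
    then obtain M where "\<And>N. M \<le> N \<Longrightarrow> X N < c"
      by (auto simp: eventually_sequentially)
    with ge[of "1 - c" M] c(2) show False
      by force
  qed
qed

text \<open>A limit would have to agree with the limsup, so the averages of the indicator would tend
  to 1 almost everywhere. Being bounded by 1, they would have means tending to 1, while invariance
  keeps each mean with N > 0 equal to |E| < 1.\<close>

lemma not_AE_convergent_averages:
  assumes E: "E \<in> sets circle_measure" "measure circle_measure E < 1"
    and pos: "\<And>j. 1 \<le> j \<Longrightarrow> 0 < n j"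
    and limsup: "AE x in circle_measure.
      limsup (\<lambda>N. ereal (1 / real N * (\<Sum>j=1..N. indicator E (circle_mult (n j) x)))) = 1"
  shows "\<not> (AE x in circle_measure. convergent (\<lambda>N. 1 / real N *
      (\<Sum>j=1..N. indicator E (circle_mult (n j) x) - measure circle_measure E)))"
proof
  define X :: "nat \<Rightarrow> circle \<Rightarrow> real"
    where "X = (\<lambda>N x. 1 / real N * (\<Sum>j=1..N. indicator E (circle_mult (n j) x)))"
  note E(1) [measurable]
  have X_bounds: "0 \<le> X N x" "X N x \<le> 1" for N x
  proof -
    show "0 \<le> X N x"
      by (auto simp: X_def intro!: divide_nonneg_nonneg sum_nonneg)
    have "(\<Sum>j=1..N. indicator E (circle_mult (n j) x)) \<le> (\<Sum>j=1..N. 1::real)"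
      by (intro sum_mono) (simp add: indicator_def)
    then show "X N x \<le> 1"
      by (cases "N = 0") (simp_all add: X_def field_simps)
  qed
  have X_meas [measurable]: "X N \<in> borel_measurable circle_measure" for N
    unfolding X_def by measurable
  assume "AE x in circle_measure. convergent (\<lambda>N. 1 / real N *
      (\<Sum>j=1..N. indicator E (circle_mult (n j) x) - measure circle_measure E))"
  then have "AE x in circle_measure. (\<lambda>N. X N x) \<longlonglongrightarrow> 1"
    using limsup
  proof eventually_elim
    case (elim x)
    then obtain L where "(\<lambda>N. 1 / real N *
      (\<Sum>j=1..N. indicator E (circle_mult (n j) x) - measure circle_measure E)) \<longlonglongrightarrow> L"
      by (auto simp: convergent_def)
    then have "(\<lambda>N. 1 / real N *
      (\<Sum>j=1..N. indicator E (circle_mult (n j) x) - measure circle_measure E)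
      + measure circle_measure E) \<longlonglongrightarrow> L + measure circle_measure E"
      by (intro tendsto_intros)
    \<comment> \<open>At N = 0 the prefactor is 0 and the constant does not cancel, so the identity
      is claimed only eventually.\<close>
    moreover have "\<forall>\<^sub>F N in sequentially. 1 / real N *
      (\<Sum>j=1..N. indicator E (circle_mult (n j) x) - measure circle_measure E)
      + measure circle_measure E = X N x"
      using eventually_gt_at_top[of 0]
      by eventually_elim (simp add: X_def sum_subtractf field_simps)
    ultimately have X_lim: "(\<lambda>N. X N x) \<longlonglongrightarrow> L + measure circle_measure E"
      by (rule Lim_transform_eventually)
    then have "limsup (\<lambda>N. ereal (X N x)) = ereal (L + measure circle_measure E)"
      by (intro lim_imp_Limsup) auto
    then have "L + measure circle_measure E = 1"
      using elim(2) by (simp add: X_def one_ereal_def)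
    then show ?case
      using X_lim by simp
  qed
  then have "(\<lambda>N. integral\<^sup>L circle_measure (X N)) \<longlonglongrightarrow> integral\<^sup>L circle_measure (\<lambda>_. 1)"
    using X_bounds
    by (intro integral_dominated_convergence[where w = "\<lambda>_. 1"]) auto
  moreover have "\<forall>\<^sub>F N in sequentially. integral\<^sup>L circle_measure (X N) = measure circle_measure E"
    using eventually_gt_at_top[of 0]
  proof eventually_elim
    case (elim N)
    have "integral\<^sup>L circle_measure (\<lambda>x. indicator E (circle_mult (n j) x)) = measure circle_measure E"
      if "1 \<le> j" for j
    proof -
      have "(\<lambda>x. indicator E (circle_mult (n j) x)) = (indicator (circle_mult (n j) -` E) :: circle \<Rightarrow> real)"
        by (auto simp: indicator_def)
      then show ?thesis
        using measure_circle_mult_vimage[OF E(1) pos[OF that]] by simp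
    qed
    moreover have "integrable circle_measure (\<lambda>x. indicator E (circle_mult (n j) x) :: real)" for j
      by (rule circle.integrable_const_bound[where B = 1]) (auto simp: indicator_def)
    ultimately show ?case
      using elim by (simp add: X_def)
  qed
  ultimately have "measure circle_measure E = 1"
    using tendsto_cong LIMSEQ_unique[OF tendsto_const] by fastforce
  then show False
    using E(2) by simp
qed

section \<open>Blocks, stages and the lacunary sequence\<close>

definition block :: "nat \<Rightarrow> nat" where
  "block j = (LEAST m. j \<le> fact (m + 1))"

text \<open>Dyadic grouping of blocks: stage k \<ge> 1 has exactly 2^k of them, one per residue
  modulo 2^k; stage 0 also absorbs block 0.\<close>

definition stage :: "nat \<Rightarrow> nat" where
  "stage j = (LEAST k. block j < 2 ^ (k + 1))"

lemma le_fact_block: "j \<le> fact (block j + 1)"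
  unfolding block_def
proof (rule LeastI_ex)
  have "j \<le> fact (j + 1)"
    using fact_ge_self[of "j + 1"] by linarith
  then show "\<exists>m. j \<le> fact (m + 1)" ..
qed

lemma block_mono: "i \<le> j \<Longrightarrow> block i \<le> block j"
  using le_fact_block[of j] unfolding block_def[of i] by (intro Least_le) simp

text \<open>Factorial endpoints make block m fill all but the fraction 1/(m + 1) of the indices up
  to (m + 1)!.\<close>

lemma block_eq:
  assumes "fact m < j" "j \<le> fact (m + 1)"
  shows "block j = m"
proof (rule antisym)
  show "block j \<le> m"
    unfolding block_def using assms(2) by (rule Least_le)
  show "m \<le> block j"
  proof (rule ccontr)
    assume "\<not> m \<le> block j"
    then have "(fact (block j + 1) :: nat) \<le> fact m"
      by (intro fact_mono) simp
    then show False
      using le_fact_block[of j] assms(1) by linarith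
  qed
qed

lemma block_less: "block j < 2 ^ (stage j + 1)"
  unfolding stage_def
proof (rule LeastI_ex)
  have "block j < 2 ^ (block j + 1)"
    using less_exp[of "block j + 1"] by linarith
  then show "\<exists>k. block j < 2 ^ (k + 1)" ..
qed

lemma stage_mono: "i \<le> j \<Longrightarrow> stage i \<le> stage j"
  using block_less[of j] block_mono[of i j] unfolding stage_def[of i]
  by (intro Least_le) linarith

lemma stage_eq:
  assumes "block j = m" "2 ^ k \<le> m" "m < 2 ^ (k + 1)"
  shows "stage j = k"
proof (rule antisym)
  show "stage j \<le> k"
    unfolding stage_def using assms by (intro Least_le) simp
  show "k \<le> stage j"
  proof (rule ccontr)
    assume "\<not> k \<le> stage j"
    then have "(2::nat) ^ (stage j + 1) \<le> 2 ^ k"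
      by (intro power_increasing) auto
    then show False
      using block_less[of j] assms by linarith
  qed
qed

text \<open>All exponents of stage \<open>k\<close> are at most \<open>horizon k\<close>, while a digit in base \<open>base k\<close>
  vanishes with probability so small that the hitting time rarely falls below this horizon.\<close>

definition horizon :: "nat \<Rightarrow> nat" where
  "horizon k = 2 ^ k * fact (2 ^ (k + 1)) + 2 ^ (k + 1)"

definition base :: "nat \<Rightarrow> nat" where
  "base k = 2 ^ k * (horizon k + 1)"

text \<open>Modulo \<open>2 ^ stage j\<close> the exponent is the block number, and the blocks of stage \<open>k\<close> are
  those numbered from \<open>2 ^ k\<close> to \<open>2 ^ (k + 1) - 1\<close>: they run through all residues.\<close>

definition expo :: "nat \<Rightarrow> nat" where
  "expo j = 2 ^ stage j * j + block j"

definition dilation :: "nat \<Rightarrow> nat" where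
  "dilation j = base (stage j) ^ expo j"

lemma horizon_mono: "k \<le> l \<Longrightarrow> horizon k \<le> horizon l"
  unfolding horizon_def by (intro add_mono mult_mono fact_mono power_increasing) auto

lemma base_mono: "k \<le> l \<Longrightarrow> base k \<le> base l"
  unfolding base_def using horizon_mono[of k l] by (intro mult_mono power_increasing) auto

lemma base_ge_2: "2 \<le> base k"
proof -
  have "0 < horizon k"
    by (simp add: horizon_def)
  then have "1 * 2 \<le> 2 ^ k * (horizon k + 1)"
    by (intro mult_mono) auto
  then show ?thesis
    by (simp add: base_def)
qed

lemma base_pos: "0 < base k"
  using base_ge_2[of k] by simp

text \<open>This ratio bounds the probability of a hit before the horizon; the factor 2^k in
  \<open>base\<close> makes it summable.\<close>

lemma horizon_div_base: "real (horizon k) / base k \<le> (1 / 2) ^ k"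
proof -
  have "real (horizon k) / base k = (1 / 2) ^ k * (horizon k / (horizon k + 1))"
    by (simp add: base_def power_divide distrib_left)
  also have "\<dots> \<le> (1 / 2) ^ k * 1"
    by (intro mult_left_mono) auto
  finally show ?thesis by simp
qed

lemma inverse_base_le: "1 / real (base k) \<le> (1 / 2) ^ k"
proof -
  have "1 / real (base k) = (1 / 2) ^ k * (1 / (horizon k + 1))"
    by (simp add: base_def power_divide distrib_left)
  also have "\<dots> \<le> (1 / 2) ^ k * 1"
    by (intro mult_left_mono) auto
  finally show ?thesis by simp
qed

lemma expo_le_horizon: "expo j \<le> horizon (stage j)"
proof -
  have "j \<le> fact (block j + 1)"
    by (rule le_fact_block)
  also have "\<dots> \<le> fact (2 ^ (stage j + 1))"
    using block_less[of j] by (intro fact_mono) simp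
  finally show ?thesis
    unfolding expo_def horizon_def using block_less[of j] by (intro add_mono mult_mono) auto
qed

text \<open>Stage and block never decrease, so the increase survives changes of block or
  stage.\<close>

lemma expo_less_Suc: "expo j < expo (Suc j)"
proof -
  have "2 ^ stage j * j < 2 ^ stage j * Suc j"
    by simp
  also have "\<dots> \<le> 2 ^ stage (Suc j) * Suc j"
    using stage_mono[of j "Suc j"] by (intro mult_right_mono power_increasing) auto
  finally show ?thesis
    unfolding expo_def using block_mono[of j "Suc j"] by simp
qed

lemma dilation_pos: "0 < dilation j"
  unfolding dilation_def using base_pos by simp

text \<open>The exponent grows by at least 1 and the base, at least 2, never decreases.\<close>

lemma dilation_Suc: "2 * dilation j \<le> dilation (Suc j)"
proof -
  have "2 * base (stage j) ^ expo j \<le> base (stage j) * base (stage j) ^ expo j"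
    using base_ge_2 by (intro mult_right_mono) auto
  also have "\<dots> = base (stage j) ^ Suc (expo j)"
    by simp
  also have "\<dots> \<le> base (stage j) ^ expo (Suc j)"
    using expo_less_Suc[of j] base_pos by (intro power_increasing) (auto simp: Suc_le_eq)
  also have "\<dots> \<le> base (stage (Suc j)) ^ expo (Suc j)"
    by (intro power_mono base_mono stage_mono) auto
  finally show ?thesis
    by (simp add: dilation_def)
qed

lemma strict_mono_dilation: "strict_mono dilation"
  unfolding strict_mono_Suc_iff using dilation_Suc dilation_pos
  by (metis add_less_same_cancel1 less_le_trans mult_2 less_add_same_cancel1)

section \<open>Sets swept by whole blocks, and the limsup of the averages\<close>

definition sweep :: "nat \<Rightarrow> circle set" where
  "sweep k = hit_mod (base k) (2 ^ k)"

lemma sweep_in_sets: "sweep k \<in> sets circle_measure"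
  unfolding sweep_def using base_pos by (rule hit_mod_in_sets)

lemma measure_sweep_le: "measure circle_measure (sweep k) \<le> 2 * (1 / 2) ^ k"
  using measure_hit_mod_le[OF base_pos, of "2 ^ k" k] inverse_base_le[of k]
  by (simp add: sweep_def power_divide)

lemma sweep_block:
  assumes "x \<in> first_hit (base k) t" "horizon k \<le> t"
  obtains m :: nat where "2 ^ k \<le> m"
    "\<And>j. fact m < j \<Longrightarrow> j \<le> fact (m + 1) \<Longrightarrow> circle_mult (dilation j) x \<in> sweep k"
proof (rule that)
  \<comment> \<open>The one block of stage k whose number is congruent to the hitting time modulo
    2^k.\<close>
  let ?m = "2 ^ k + t mod 2 ^ k"
  show "2 ^ k \<le> ?m" by simp
  fix j :: nat assume "fact ?m < j" "j \<le> fact (?m + 1)"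
  then have block: "block j = ?m"
    by (rule block_eq)
  have "t mod 2 ^ k < 2 ^ k" by simp
  then have stage: "stage j = k"
    by (intro stage_eq[OF block]) auto
  have "expo j \<le> t"
    using expo_le_horizon[of j] assms(2) stage by simp
  moreover have "expo j mod 2 ^ k = t mod 2 ^ k"
    by (simp add: expo_def stage block)
  ultimately show "circle_mult (dilation j) x \<in> sweep k"
    unfolding dilation_def sweep_def stage using assms(1) by (intro circle_mult_in_hit_mod)
qed

text \<open>Hits before the horizon have summable probabilities, so Borel-Cantelli excludes them for
  all large k.\<close>

lemma AE_late_hit:
  "AE x in circle_measure. \<forall>\<^sub>F k in sequentially. \<exists>t\<ge>horizon k. x \<in> first_hit (base k) t"
proof -
  define A where "A = (\<lambda>k. \<Union>t<horizon k. first_hit (base k) t)"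
  have A_sets: "A k \<in> sets circle_measure" for k
    unfolding A_def using base_pos by (intro sets.finite_UN first_hit_in_sets) auto
  have "measure circle_measure (A k) \<le> (1 / 2) ^ k" for k
  proof -
    have "measure circle_measure (A k) \<le> (\<Sum>t<horizon k. measure circle_measure (first_hit (base k) t))"
      unfolding A_def using base_pos
      by (intro circle.finite_measure_subadditive_finite) auto
    also have "\<dots> \<le> (\<Sum>t<horizon k. 1 / base k)"
      by (intro sum_mono measure_first_hit_le base_pos)
    also have "\<dots> \<le> (1 / 2) ^ k"
      using horizon_div_base[of k] by simp
    finally show ?thesis .
  qed
  then have "summable (\<lambda>k. measure circle_measure (A k))"
    by (intro summable_comparison_test'[OF summable_geometric[of "1 / 2 :: real"]]) auto
  then have "AE x in circle_measure. \<forall>\<^sub>F k in sequentially. x \<in> space circle_measure - A k"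
    using A_sets by (intro borel_cantelli_AE1) (auto simp: circle.emeasure_eq_measure)
  \<comment> \<open>Avoiding \<open>A k\<close> only rules out early hits; that a hit occurs at all
    comes from here.\<close>
  moreover have "AE x in circle_measure. \<forall>k. \<exists>t. x \<in> first_hit (base k) t"
    unfolding AE_all_countable using AE_first_hit base_pos by blast
  ultimately show ?thesis
  proof eventually_elim
    case (elim x)
    from elim(1) show ?case
    proof eventually_elim
      case (elim k)
      obtain t where "x \<in> first_hit (base k) t"
        using \<open>\<forall>k. \<exists>t. x \<in> first_hit (base k) t\<close> by blast
      moreover from this have "horizon k \<le> t"
        using elim by (auto simp: A_def not_less)
      ultimately show ?case by blast
    qed
  qed
qed

text \<open>Counting only the indices of block m already gives ((m + 1)! - m!) / (m + 1)!.\<close>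

lemma average_ge:
  fixes n :: "nat \<Rightarrow> nat"
  assumes "\<And>j. fact m < j \<Longrightarrow> j \<le> fact (m + 1) \<Longrightarrow> circle_mult (n j) x \<in> E"
  shows "1 - 1 / real (m + 1)
    \<le> 1 / real (fact (m + 1)) * (\<Sum>j=1..fact (m + 1). indicator E (circle_mult (n j) x))"
proof -
  have "real (fact (m + 1)) - real (fact m) = real (fact (m + 1) - fact m)"
    by (intro of_nat_diff[symmetric] fact_mono) simp
  also have "\<dots> = (\<Sum>j\<in>{fact m<..fact (m + 1) :: nat}. 1 :: real)"
    by (simp only: sum_constant card_greaterThanAtMost mult_1_right)
  also have "\<dots> = (\<Sum>j\<in>{fact m<..fact (m + 1)}. indicator E (circle_mult (n j) x))"
    using assms by (intro sum.cong) auto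
  also have "\<dots> \<le> (\<Sum>j=1..fact (m + 1). indicator E (circle_mult (n j) x))"
    by (intro sum_mono2) auto
  finally have "1 / real (fact (m + 1)) * (real (fact (m + 1)) - real (fact m))
      \<le> 1 / real (fact (m + 1)) * (\<Sum>j=1..fact (m + 1). indicator E (circle_mult (n j) x))"
    by (intro mult_left_mono) auto
  moreover have "1 / (c * f) * (c * f - f) = 1 - 1 / c" if "0 < c" "0 < f" for c f :: real
    using that by (simp add: field_simps)
  from this[of "real (m + 1)" "real (fact m)"]
  have "1 / real (fact (m + 1)) * (real (fact (m + 1)) - real (fact m)) = 1 - 1 / real (m + 1)"
    by (simp add: algebra_simps)
  ultimately show ?thesis by simp
qed

lemma AE_limsup_averages:
  assumes "\<And>k. K \<le> k \<Longrightarrow> sweep k \<subseteq> E"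
  shows "AE x in circle_measure.
    limsup (\<lambda>N. ereal (1 / real N * (\<Sum>j=1..N. indicator E (circle_mult (dilation j) x)))) = 1"
  using AE_late_hit
proof eventually_elim
  case (elim x)
  show ?case
  proof (rule limsup_ereal_eq_1)
    fix N :: nat
    have "(\<Sum>j=1..N. indicator E (circle_mult (dilation j) x)) \<le> (\<Sum>j=1..N. 1::real)"
      by (intro sum_mono) (simp add: indicator_def)
    then show "1 / real N * (\<Sum>j=1..N. indicator E (circle_mult (dilation j) x)) \<le> 1"
      by (cases "N = 0") (simp_all add: field_simps)
  next
    fix e :: real and M :: nat assume "0 < e"
    then obtain i where i: "1 / real (Suc i) < e"
      using nat_approx_posE by blast
    \<comment> \<open>Since the block number m found below is at least k, these bounds put
      \<open>sweep k\<close> inside \<open>E\<close>, the block's end beyond \<open>M\<close>, and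
      the error 1/(m + 1) below \<open>e\<close>.\<close>
    obtain k where k: "K \<le> k" "M \<le> k" "i \<le> k" "\<exists>t\<ge>horizon k. x \<in> first_hit (base k) t"
      using eventually_happens'[OF _ eventually_conj[OF elim eventually_ge_at_top[of "max K (max M i)"]]]
      by auto
    then obtain m where m: "2 ^ k \<le> m"
      "\<And>j. fact m < j \<Longrightarrow> j \<le> fact (m + 1) \<Longrightarrow> circle_mult (dilation j) x \<in> sweep k"
      using sweep_block by metis
    have "k \<le> m"
      using less_exp[of k] m(1) by linarith
    have "M \<le> fact (m + 1)"
      using fact_ge_self[of "m + 1"] \<open>k \<le> m\<close> k(2) by linarith
    moreover have "1 / real (m + 1) \<le> 1 / real (Suc i)"
      using \<open>k \<le> m\<close> k(3) by (intro divide_left_mono) auto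
    then have "1 - e \<le> 1 - 1 / real (m + 1)"
      using i by linarith
    moreover have "1 - 1 / real (m + 1)
      \<le> 1 / real (fact (m + 1)) * (\<Sum>j=1..fact (m + 1). indicator E (circle_mult (dilation j) x))"
      by (rule average_ge) (use m(2) assms k(1) in blast)
    ultimately show "\<exists>N\<ge>M. 1 - e \<le> 1 / real N * (\<Sum>j=1..N. indicator E (circle_mult (dilation j) x))"
      by (meson order_trans)
  qed
qed

section \<open>Choice of the set and assembly\<close>

theorem theorem1p7:
  fixes \<epsilon> :: real
  assumes "0 < \<epsilon>" "\<epsilon> < 1"
  shows "\<exists>(E :: circle set) (n :: nat \<Rightarrow> nat).
    E \<in> sets circle_measure \<and>
    (\<forall>j\<ge>1. n j > 0) \<and>
    strict_mono_on {1..} n \<and>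
    (\<forall>j\<ge>1. real (n (j + 1)) / real (n j) \<ge> 2) \<and>
    measure circle_measure E < \<epsilon> \<and>
    (AE x in circle_measure.
      limsup (\<lambda>N. ereal (1 / real N * (\<Sum>j=1..N. indicator E (circle_mult (n j) x)))) = 1) \<and>
    (let g = (\<lambda>x. indicator E x - measure circle_measure E) in
      bounded (range g) \<and>
      integrable circle_measure g \<and>
      (LINT x|circle_measure. g x) = 0 \<and>
      \<not> (AE x in circle_measure.
          convergent (\<lambda>N. 1 / real N * (\<Sum>j=1..N. g (circle_mult (n j) x)))))"
proof -
  \<comment> \<open>The sets \<open>sweep k\<close> with k \<ge> K have measures at most 2 *
    (1/2)^k, with geometric tail 4 * (1/2)^K.\<close>
  obtain K where K: "(1 / 2) ^ K < \<epsilon> / 4"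
    using real_arch_pow_inv[of "\<epsilon> / 4" "1 / 2"] assms(1) by auto
  define E where "E = (\<Union>k. sweep (k + K))"
  have E_sets: "E \<in> sets circle_measure"
    unfolding E_def using sweep_in_sets by auto
  have E_measure: "measure circle_measure E < \<epsilon>"
  proof -
    have geo: "(\<lambda>k. 2 * (1 / 2) ^ K * (1 / 2) ^ k) sums (2 * (1 / 2) ^ K * (1 / (1 - 1 / 2 :: real)))"
      by (intro sums_mult geometric_sums) simp
    have le: "measure circle_measure (sweep (k + K)) \<le> 2 * (1 / 2) ^ K * (1 / 2) ^ k" for k
      using measure_sweep_le[of "k + K"] by (simp add: power_add mult_ac)
    then have sm: "summable (\<lambda>k. measure circle_measure (sweep (k + K)))"
      by (intro summable_comparison_test'[OF sums_summable[OF geo]]) auto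
    have "measure circle_measure E \<le> (\<Sum>k. measure circle_measure (sweep (k + K)))"
      unfolding E_def using sweep_in_sets sm
      by (intro circle.finite_measure_subadditive_countably) auto
    also have "\<dots> \<le> (\<Sum>k. 2 * (1 / 2) ^ K * (1 / 2) ^ k)"
      using le sm sums_summable[OF geo] by (rule suminf_le)
    also have "\<dots> = 4 * (1 / 2) ^ K"
      using sums_unique[OF geo] by simp
    finally show ?thesis
      using K by linarith
  qed
  have E_limsup: "AE x in circle_measure.
      limsup (\<lambda>N. ereal (1 / real N * (\<Sum>j=1..N. indicator E (circle_mult (dilation j) x)))) = 1"
  proof (rule AE_limsup_averages)
    show "sweep k \<subseteq> E" if "K \<le> k" for k
      using that unfolding E_def by (metis UN_upper UNIV_I le_add_diff_inverse2)
  qed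
  define g :: "circle \<Rightarrow> real" where "g = (\<lambda>x. indicator E x - measure circle_measure E)"
  have g_bounded: "bounded (range g)"
  proof (rule boundedI)
    fix y assume "y \<in> range g"
    then obtain x where "y = indicator E x - measure circle_measure E"
      by (auto simp: g_def)
    moreover have "0 \<le> measure circle_measure E"
      by (rule measure_nonneg)
    ultimately show "norm y \<le> 1"
      using measure_circle_le_1[of E] unfolding real_norm_def
      by (cases "x \<in> E") (simp_all add: abs_le_iff)
  qed
  have E_integrable: "integrable circle_measure (indicator E :: circle \<Rightarrow> real)"
    using E_sets by (intro integrable_real_indicator) (simp_all add: circle.emeasure_eq_measure)
  then have g_integrable: "integrable circle_measure g"
    unfolding g_def by (intro Bochner_Integration.integrable_diff) auto
  have "integral\<^sup>L circle_measure g
      = integral\<^sup>L circle_measure (indicator E) - (LINT x|circle_measure. measure circle_measure E)"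
    unfolding g_def using E_integrable by (intro Bochner_Integration.integral_diff) auto
  then have g_mean: "integral\<^sup>L circle_measure g = 0"
    using E_sets by simp
  have "\<not> (AE x in circle_measure.
      convergent (\<lambda>N. 1 / real N * (\<Sum>j=1..N. g (circle_mult (dilation j) x))))"
    unfolding g_def using E_sets E_measure assms(2) dilation_pos E_limsup
    by (intro not_AE_convergent_averages) auto
  moreover have "strict_mono_on {1..} dilation"
    using strict_mono_dilation by (auto simp: strict_mono_on_def strict_mono_def)
  moreover have "real (dilation (j + 1)) / real (dilation j) \<ge> 2" for j
    using of_nat_mono[OF dilation_Suc[of j], where ?'a = real] dilation_pos[of j]
    by (simp add: le_divide_eq)
  ultimately show ?thesis
    using E_sets dilation_pos E_measure E_limsup g_bounded g_integrable g_mean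
    unfolding Let_def g_def by (intro exI[of _ E] exI[of _ dilation]) auto
qed

end
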